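(* Let $d\geq 2$. Suppose that $\phi:(0,1]\to[0,\infty)$ is increasing and satisfies $$\#\bigl\{\omega : \omega \text{ is a length-}n\text{ self-avoiding bridge in } \mathbb{Z}^d \text{ from } 0 \text{ to } \mathbb{Z}^{d-1}\times\{m,m+1,\ldots\}\bigr\} \leq b_n\exp\left[-\phi\left(\frac{m}{n}\right)n\right]$$ for all integers $n\geq m>0$. Define $\Phi:(0,1]\to[0,\infty)$ by $$\Phi(\varepsilon)=\inf_{\varepsilon\leq\delta\leq 1}\delta^{-1}\phi(\delta),$$ define $\psi:(0,1)\to[1,\infty)$ by $$\psi(\varepsilon)=\sup\left\{\lambda\geq 1 : \varepsilon\leq 1-\exp\left[-\frac{\Phi(\lambda^{-1})}{\lambda-1}\right]\right\},$$ where the condition is regarded as satisfied at $\lambda=1$, and define $\Psi:\{0,1,\ldots\}\to[0,\infty)$ by $$\Psi(n)=\inf_{0<\varepsilon<1}\left[2\left[1-(1-\varepsilon)^{\psi(\varepsilon)}\right]^{-1}-(n+1)\log(1-\varepsilon)\right].$$ Then $$c_n\leq\exp\left[\Psi(n)-2\right]\mu_c^{n+1}$$ for every $n\geq 0$.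
   Context: A self-avoiding walk (SAW) of length $n$ on the hypercubic lattice $\mathbb{Z}^d$ is a nearest-neighbour path $(\omega_0,\ldots,\omega_n)$ in $\mathbb{Z}^d$ that does not visit any vertex more than once. $c_n$ denotes the number of length-$n$ self-avoiding walks starting at the origin, and $\mu_c=\mu_c(d)=\lim_{n\to\infty}c_n^{1/n}$ is the connective constant of $\mathbb{Z}^d$. A self-avoiding bridge (SAB) is a self-avoiding walk whose $d$th coordinate is uniquely minimized by its starting point and is maximized (not necessarily uniquely) by its endpoint. $b_n$ denotes the number of length-$n$ self-avoiding bridges starting at the origin (so $b_0=1$). A walk goes from $v$ to a set $A$ if it starts at $v$ and ends in $A$. "Increasing" is meant in the non-strict sense (e.g. $\phi\equiv 0$ is allowed). *)

theory Defs
  imports Complex_Main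
begin

text \<open>
  The lattice $\mathbb{Z}^d$ is the set of functions \<open>x :: nat \<Rightarrow> int\<close> that vanish outside
  \<open>{1..d}\<close>; the coordinates of \<open>x\<close> are \<open>x 1, \<dots>, x d\<close> and the origin is \<open>\<lambda>_. 0\<close>.
\<close>

type_synonym vertex = "nat \<Rightarrow> int"

definition lattice :: "nat \<Rightarrow> vertex set" where
  "lattice d = {x. \<forall>i. i \<notin> {1..d} \<longrightarrow> x i = 0}"

definition origin :: vertex where
  "origin = (\<lambda>_. 0)"

definition adjacent :: "nat \<Rightarrow> vertex \<Rightarrow> vertex \<Rightarrow> bool" where
  "adjacent d x y \<longleftrightarrow> (\<Sum>i=1..d. \<bar>x i - y i\<bar>) = 1"

text \<open>A walk of length \<open>n\<close> is the list of its \<open>n + 1\<close> vertices.\<close>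

definition self_avoiding_walk :: "nat \<Rightarrow> nat \<Rightarrow> vertex list \<Rightarrow> bool" where
  "self_avoiding_walk d n \<omega> \<longleftrightarrow>
     length \<omega> = n + 1 \<and> set \<omega> \<subseteq> lattice d \<and> successively (adjacent d) \<omega> \<and> distinct \<omega>"

definition self_avoiding_bridge :: "nat \<Rightarrow> nat \<Rightarrow> vertex list \<Rightarrow> bool" where
  "self_avoiding_bridge d n \<omega> \<longleftrightarrow>
     self_avoiding_walk d n \<omega> \<and>
     (\<forall>i\<in>{1..n}. (\<omega> ! 0) d < (\<omega> ! i) d) \<and>
     (\<forall>i\<in>{0..n}. (\<omega> ! i) d \<le> (\<omega> ! n) d)"

definition goes_from_to :: "vertex list \<Rightarrow> vertex \<Rightarrow> vertex set \<Rightarrow> bool" where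
  "goes_from_to \<omega> v A \<longleftrightarrow> hd \<omega> = v \<and> last \<omega> \<in> A"

definition saw_count :: "nat \<Rightarrow> nat \<Rightarrow> nat" where
  "saw_count d n = card {\<omega>. self_avoiding_walk d n \<omega> \<and> hd \<omega> = origin}"

definition sab_count :: "nat \<Rightarrow> nat \<Rightarrow> nat" where
  "sab_count d n = card {\<omega>. self_avoiding_bridge d n \<omega> \<and> hd \<omega> = origin}"

definition connective_constant :: "nat \<Rightarrow> real" where
  "connective_constant d = lim (\<lambda>n. real (saw_count d n) powr (1 / real n))"

text \<open>The set $\mathbb{Z}^{d-1} \times \{m, m+1, \ldots\}$.\<close>

definition upper_half_space :: "nat \<Rightarrow> nat \<Rightarrow> vertex set" where
  "upper_half_space d m = {x \<in> lattice d. int m \<le> x d}"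

text \<open>
  The functions \<open>\<Phi>\<close>, \<open>\<psi>\<close> and \<open>\<Psi>\<close> are only meaningful for \<open>\<phi>\<close> increasing and nonnegative on
  \<open>{0<..1}\<close> and for arguments in \<open>{0<..1}\<close>, \<open>{0<..<1}\<close> and the naturals respectively; there all
  the infima and suprema below are over nonempty sets bounded on the relevant side.
\<close>

definition Phi :: "(real \<Rightarrow> real) \<Rightarrow> real \<Rightarrow> real" where
  "Phi \<phi> \<epsilon> = (INF \<delta>\<in>{\<epsilon>..1}. inverse \<delta> * \<phi> \<delta>)"

text \<open>
  The disjunct \<open>l = 1\<close> is needed because \<open>x / 0 = 0\<close> would make the condition false at \<open>l = 1\<close>.
\<close>

definition psi :: "(real \<Rightarrow> real) \<Rightarrow> real \<Rightarrow> real" where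
  "psi \<phi> \<epsilon> = Sup {l. l \<ge> 1 \<and> (l = 1 \<or> \<epsilon> \<le> 1 - exp (- (Phi \<phi> (inverse l) / (l - 1))))}"

definition Psi :: "(real \<Rightarrow> real) \<Rightarrow> nat \<Rightarrow> real" where
  "Psi \<phi> n = (INF \<epsilon>\<in>{0<..<1}.
     2 * inverse (1 - (1 - \<epsilon>) powr psi \<phi> \<epsilon>) - (real n + 1) * ln (1 - \<epsilon>))"

end

theory Submission
  imports Defs "HOL-Library.Function_Algebras"
begin

text \<open>
  Write $\mu$ for the connective constant. For $z \ge 0$ let $B_m(z)$ be the generating function
  $\sum_\omega z^{|\omega|}$ of the bridges from the origin whose endpoint has height exactly $m$,
  and $H(z)$ that of the half-space walks, whose vertices after the origin all have positive
  height. Throughout, the generating functions are truncated at a length $N$, and all bounds are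
  uniform in $N$, so that no question of convergence arises.

  A walk of length $n$ is cut at its last vertex of minimal height. The part after the cut is a
  half-space walk, and so is the reversed part before the cut once a vertical step is put in front
  of it; hence $c_n z^{n+1} \le H(z)^2$ (\<open>saw_count_le_half_space_walks\<close>). A half-space walk that
  reaches maximal height $A$ is cut at its last vertex of height $A$. The first part is a bridge
  of height $A$; the second part, reflected, is a half-space walk of height less than $A$ because
  the original walk stays above the hyperplane through its start. By induction on the height,
  $H(z) \le \prod_{m \ge 1} (1 + B_m(z)) \le \exp \sum_{m \ge 1} B_m(z)$
  (\<open>gf_half_space_walks_le\<close>).

  It remains to show $B_m(z) \le (1 - \varepsilon)^{\psi(\varepsilon) m}$ at
  $z = (1 - \varepsilon) / \mu$, for then the geometric series gives
  $H(z) \le \exp ([1 - (1 - \varepsilon)^{\psi(\varepsilon)}]^{-1} - 1)$. Let $\lambda$ belong to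
  the set whose supremum is $\psi(\varepsilon)$. By supermultiplicativity of bridges,
  $b_n \le \mu^n$. The bridges of length $n$ and height $m$, of which there are none if $n < m$,
  therefore contribute at most $(1 - \varepsilon)^n$. If $n \ge \lambda m$, this is at most $(1 - \varepsilon)^{\lambda m}$.
  If $m \le n < \lambda m$, the bridge is so steep that the hypothesis gains a further factor
  $\exp (- \phi(m/n) n) \le \exp (- m \Phi(\lambda^{-1})) \le (1 - \varepsilon)^{(\lambda - 1) m}$,
  and $(1 - \varepsilon)^n \le (1 - \varepsilon)^m$ supplies the rest. Summation over the lengths
  up to $N$ costs a factor linear in $N$, which disappears on taking $k$-th roots, because
  concatenation gives $B_m(z)^k \le B_{km}(z)$ with truncation at $kN$ on the right
  (\<open>gf_bridges_le_powr\<close>).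
\<close>

section \<open>Self-avoiding walks from the origin\<close>

text \<open>
  A walk from the origin is represented by the list of the vertices after the origin, so that
  the length of the list is the length of the walk and concatenation of walks is, up to a
  translation, the append of lists.
\<close>

definition saw :: "nat \<Rightarrow> vertex list \<Rightarrow> bool" where
  "saw d xs \<longleftrightarrow> set xs \<subseteq> lattice d \<and> successively (adjacent d) (0 # xs) \<and> distinct (0 # xs)"

definition endpoint :: "vertex list \<Rightarrow> vertex" where
  "endpoint xs = last (0 # xs)"

definition join :: "vertex list \<Rightarrow> vertex list \<Rightarrow> vertex list" where
  "join xs ys = xs @ map ((+) (endpoint xs)) ys"

lemma origin_eq_0: "origin = 0"
  by (simp add: origin_def zero_fun_def)

lemma endpoint_Nil [simp]: "endpoint [] = 0"
  and endpoint_snoc [simp]: "endpoint (xs @ [x]) = x"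
  by (simp_all add: endpoint_def)

lemma endpoint_in: "endpoint xs \<in> set (0 # xs)"
  unfolding endpoint_def by (rule last_in_set) simp

lemma lattice_0 [simp]: "0 \<in> lattice d"
  and lattice_diff: "x \<in> lattice d \<Longrightarrow> y \<in> lattice d \<Longrightarrow> x - y \<in> lattice d"
  by (auto simp: lattice_def)

lemma lattice_add_iff: "v \<in> lattice d \<Longrightarrow> v + x \<in> lattice d \<longleftrightarrow> x \<in> lattice d"
  by (auto simp: lattice_def)

lemma saw_endpoint_lattice: "saw d xs \<Longrightarrow> endpoint xs \<in> lattice d"
  using endpoint_in[of xs] by (auto simp: saw_def)

lemma adjacent_translate [simp]: "adjacent d (v + x) (v + y) \<longleftrightarrow> adjacent d x y"
  by (simp add: adjacent_def)

lemma adjacent_commute: "adjacent d x y \<longleftrightarrow> adjacent d y x"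
  by (simp add: adjacent_def abs_minus_commute)

lemma successively_translate:
  "successively (adjacent d) (map ((+) v) xs) \<longleftrightarrow> successively (adjacent d) xs"
  by (simp add: successively_map)

lemma successively_glue:
  "successively P (xs @ v # ys) \<longleftrightarrow> successively P (xs @ [v]) \<and> successively P (v # ys)"
  by (cases xs rule: rev_cases) (auto simp: successively_append_iff)

text \<open>
  Used in both directions: to glue two walks and, through \<open>split_join\<close>, to cut one. The condition
  that the second walk avoids the origin is contained in the disjointness, since the endpoint of
  the first walk is one of its vertices.
\<close>

lemma saw_join_iff:
  "saw d (join xs ys) \<longleftrightarrow>
     saw d xs \<and> saw d ys \<and> set (0 # xs) \<inter> (+) (endpoint xs) ` set ys = {}"
proof -
  let ?v = "endpoint xs" and ?zs = "map ((+) (endpoint xs)) ys"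
  have v: "?v \<in> lattice d" if "set xs \<subseteq> lattice d"
    using that endpoint_in[of xs] by auto
  have adj: "successively (adjacent d) (0 # join xs ys) \<longleftrightarrow>
      successively (adjacent d) (0 # xs) \<and> successively (adjacent d) (0 # ys)"
  proof -
    have "successively (adjacent d) (0 # join xs ys) \<longleftrightarrow>
        successively (adjacent d) (butlast (0 # xs) @ ?v # ?zs)"
      by (simp add: join_def endpoint_def del: last.simps butlast.simps)
         (metis append.assoc append_Cons append_Nil append_butlast_last_id list.distinct(1))
    also have "\<dots> \<longleftrightarrow> successively (adjacent d) (0 # xs) \<and> successively (adjacent d) (?v # ?zs)"
      by (subst successively_glue) (simp add: endpoint_def del: last.simps butlast.simps)
    also have "?v # ?zs = map ((+) ?v) (0 # ys)"
      by simp
    finally show ?thesis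
      by (simp only: successively_translate)
  qed
  have dist: "distinct (0 # join xs ys) \<longleftrightarrow>
      distinct (0 # xs) \<and> distinct ys \<and> set (0 # xs) \<inter> (+) ?v ` set ys = {}"
    by (auto simp: join_def distinct_map)
  have ys0: "0 \<notin> set ys" if "set (0 # xs) \<inter> (+) ?v ` set ys = {}"
    using that endpoint_in[of xs] by force
  have lat: "set (join xs ys) \<subseteq> lattice d \<longleftrightarrow> set xs \<subseteq> lattice d \<and> set ys \<subseteq> lattice d"
    using v lattice_add_iff[of ?v d] by (auto simp: join_def)
  show ?thesis
    unfolding saw_def lat adj dist using ys0 by auto
qed

lemma endpoint_join: "endpoint (join xs ys) = endpoint xs + endpoint ys"
  by (cases ys rule: rev_cases) (auto simp: join_def, simp add: endpoint_def)

lemma length_join [simp]: "length (join xs ys) = length xs + length ys"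
  by (simp add: join_def)

lemma split_join: "xs @ ys = join xs (map (\<lambda>x. x - endpoint xs) ys)"
  by (simp add: join_def comp_def)

section \<open>Bridges and their concatenation\<close>

definition bridge :: "nat \<Rightarrow> vertex list \<Rightarrow> bool" where
  "bridge d xs \<longleftrightarrow> saw d xs \<and> (\<forall>x\<in>set xs. 0 < x d \<and> x d \<le> endpoint xs d)"

lemma bridge_height_nonneg: "bridge d xs \<Longrightarrow> 0 \<le> endpoint xs d"
  by (cases xs rule: rev_cases) (auto simp: bridge_def)

text \<open>
  The vertices of the first bridge lie weakly below its endpoint and those of the second strictly
  above it, so the two parts cannot meet.
\<close>

lemma bridge_join:
  assumes "bridge d xs" "bridge d ys"
  shows "bridge d (join xs ys)"
proof -
  let ?v = "endpoint xs"
  have v: "0 \<le> ?v d" and w: "0 \<le> endpoint ys d"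
    using assms by (auto intro: bridge_height_nonneg)
  have below: "x d \<le> ?v d" if "x \<in> set (0 # xs)" for x
    using that assms(1) v by (auto simp: bridge_def)
  have above: "?v d < (?v + y) d" if "y \<in> set ys" for y
    using that assms(2) by (auto simp: bridge_def)
  have "set (0 # xs) \<inter> (+) ?v ` set ys = {}"
    using below above by (fastforce simp del: list.set plus_fun_apply simp: not_less[symmetric])
  hence "saw d (join xs ys)"
    using assms by (simp add: saw_join_iff bridge_def)
  moreover have "0 < x d \<and> x d \<le> endpoint (join xs ys) d" if x: "x \<in> set (join xs ys)" for x
  proof -
    consider "x \<in> set xs" | y where "y \<in> set ys" "x = ?v + y"
      using x by (auto simp: join_def)
    thus ?thesis
    proof cases
      case 1
      thus ?thesis using assms(1) w by (fastforce simp: bridge_def endpoint_join)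
    next
      case 2
      thus ?thesis using assms(2) v by (force simp: bridge_def endpoint_join)
    qed
  qed
  ultimately show ?thesis by (simp add: bridge_def)
qed

lemma join_inject_length:
  assumes "join xs ys = join xs' ys'" "length xs = length xs'"
  shows "xs = xs' \<and> ys = ys'"
proof -
  have "xs = xs'" using assms by (simp add: join_def)
  thus ?thesis using assms by (auto simp: join_def inj_map_eq_map)
qed

text \<open>
  The first bridge ends at the last visit of the concatenation to the height of the junction, so
  that this height alone, without the two lengths, determines the junction.
\<close>

lemma join_inject_height:
  assumes "join xs ys = join xs' ys'" "bridge d xs" "bridge d ys" "bridge d xs'" "bridge d ys'"
    and "endpoint xs d = endpoint xs' d"
  shows "xs = xs' \<and> ys = ys'"
proof -
  have aux: "\<not> length us < length us'"
    if "join us vs = join us' vs'" "bridge d vs" "bridge d us'" "endpoint us d = endpoint us' d"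
    for us vs us' vs'
  proof
    assume l: "length us < length us'"
    \<comment> \<open>The first vertex after the shorter first part is strictly above the common height in one
      decomposition, but still belongs to the first bridge in the other.\<close>
    have "length vs > 0" using l arg_cong[OF that(1), of length] by (cases vs) auto
    hence "join us vs ! length us = endpoint us + vs ! 0" "vs ! 0 \<in> set vs"
      by (auto simp: join_def nth_append)
    moreover have "join us' vs' ! length us = us' ! length us" "us' ! length us \<in> set us'"
      using l by (auto simp: join_def nth_append)
    ultimately have "endpoint us + vs ! 0 \<in> set us'"
      using that(1) by simp
    hence "endpoint us d + (vs ! 0) d \<le> endpoint us' d"
      using that(3) by (auto simp: bridge_def)
    moreover have "0 < (vs ! 0) d"
      using that(2) \<open>vs ! 0 \<in> set vs\<close> by (auto simp: bridge_def)
    ultimately show False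
      using that(4) by simp
  qed
  have "length xs = length xs'"
    using aux[OF assms(1,3,4,6)] aux[OF assms(1)[symmetric] assms(5,2) assms(6)[symmetric]]
    by simp
  thus ?thesis using join_inject_length assms(1) by blast
qed

section \<open>Finiteness and the counting functions\<close>

lemma adjacent_coord:
  assumes "adjacent d x y" "i \<in> {1..d}"
  shows "\<bar>x i - y i\<bar> \<le> 1"
  using member_le_sum[of i "{1..d}" "\<lambda>i. \<bar>x i - y i\<bar>"] assms by (simp add: adjacent_def)

text \<open>
  A walk moves by at most one in each coordinate per step. This confines the walks of bounded
  length to a finite box and bounds the height of a walk by its length.
\<close>

lemma saw_bounded:
  "saw d xs \<Longrightarrow> x \<in> set xs \<Longrightarrow> \<bar>x i\<bar> \<le> int (length xs)"
proof (induction xs arbitrary: x rule: rev_induct)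
  case (snoc y xs)
  have saw: "saw d xs"
    using snoc.prems(1) by (subst (asm) split_join) (auto simp: saw_join_iff)
  have e: "\<bar>endpoint xs i\<bar> \<le> int (length xs)"
    using snoc.IH[OF saw] endpoint_in[of xs] by auto
  have "adjacent d (endpoint xs) y"
    using snoc.prems(1) successively_append_iff[of "adjacent d" "0 # xs" "[y]"]
    by (simp add: saw_def endpoint_def)
  moreover have "y \<in> lattice d"
    using snoc.prems(1) by (simp add: saw_def)
  ultimately have "\<bar>y i\<bar> \<le> int (length xs) + 1"
    using e adjacent_coord[of d "endpoint xs" y i] by (cases "i \<in> {1..d}") (auto simp: lattice_def)
  thus ?case using snoc.IH[OF saw, of x] snoc.prems(2) by auto
qed simp

lemma finite_saw: "finite {xs. saw d xs \<and> length xs \<le> N}"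
proof -
  let ?V = "{x :: vertex. \<forall>i. (i \<in> {1..d} \<longrightarrow> x i \<in> {- int N..int N}) \<and> (i \<notin> {1..d} \<longrightarrow> x i = 0)}"
  have "finite {xs. set xs \<subseteq> ?V \<and> length xs \<le> N}"
    by (intro finite_lists_length_le finite_set_of_finite_funs) auto
  moreover have "x \<in> ?V" if "saw d xs" "length xs \<le> N" "x \<in> set xs" for xs x
  proof -
    have "x i \<in> {- int N..int N}" for i
      using saw_bounded[OF that(1,3), of i] that(2) by (simp add: abs_le_iff)
    moreover have "x i = 0" if "i \<notin> {1..d}" for i
      using that \<open>saw d xs\<close> \<open>x \<in> set xs\<close> by (auto simp: saw_def lattice_def)
    ultimately show ?thesis by simp
  qed
  hence "{xs. saw d xs \<and> length xs \<le> N} \<subseteq> {xs. set xs \<subseteq> ?V \<and> length xs \<le> N}"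
    by blast
  ultimately show ?thesis by (rule finite_subset[rotated])
qed

lemma finite_saw_subset: "(\<And>xs. P xs \<Longrightarrow> saw d xs \<and> length xs \<le> N) \<Longrightarrow> finite {xs. P xs}"
  by (rule finite_subset[OF _ finite_saw[of d N]]) blast

lemma finite_bridges_of_length: "finite {xs. bridge d xs \<and> length xs = n}"
  by (rule finite_saw_subset[of _ d n]) (auto simp: bridge_def)

lemma walk_from_origin_iff:
  "self_avoiding_walk d n \<omega> \<and> hd \<omega> = origin \<longleftrightarrow> (\<exists>xs. \<omega> = 0 # xs \<and> saw d xs \<and> length xs = n)"
  by (cases \<omega>) (auto simp: self_avoiding_walk_def saw_def origin_eq_0)

lemma bridge_from_origin_iff:
  "self_avoiding_bridge d n \<omega> \<and> hd \<omega> = origin \<longleftrightarrow> (\<exists>xs. \<omega> = 0 # xs \<and> bridge d xs \<and> length xs = n)"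
proof -
  have "(\<forall>i\<in>{1..n}. ((0 # xs) ! 0) d < ((0 # xs) ! i) d) \<and> (\<forall>i\<in>{0..n}. ((0 # xs) ! i) d \<le> ((0 # xs) ! n) d)
     \<longleftrightarrow> (\<forall>x\<in>set xs. 0 < x d \<and> x d \<le> endpoint xs d)" (is "?L \<longleftrightarrow> ?R")
    if n: "length xs = n" for xs :: "vertex list"
  proof -
    have e: "(0 # xs) ! n = endpoint xs"
      using n last_conv_nth[of "0 # xs"] by (simp add: endpoint_def)
    show ?thesis
    proof
      assume L: ?L
      show ?R
      proof
        fix x assume "x \<in> set xs"
        then obtain j where "j < n" "x = (0 # xs) ! Suc j" using n by (auto simp: in_set_conv_nth)
        thus "0 < x d \<and> x d \<le> endpoint xs d"
          using L[THEN conjunct1, THEN bspec, of "Suc j"] L[THEN conjunct2, THEN bspec, of "Suc j"] e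
          by simp
      qed
    next
      assume R: ?R
      have "(0 # xs) ! i \<in> set xs" if "i \<in> {1..n}" for i
        using that n by (auto simp: nth_Cons')
      moreover have "0 \<le> endpoint xs d"
        using R endpoint_in[of xs] by auto
      ultimately show ?L
        unfolding e using R by (auto simp: nth_Cons' split: if_splits)
    qed
  qed
  note heights = this
  show ?thesis
  proof
    assume L: "self_avoiding_bridge d n \<omega> \<and> hd \<omega> = origin"
    then obtain xs where xs: "\<omega> = 0 # xs" "saw d xs" "length xs = n"
      using walk_from_origin_iff[of d n \<omega>] by (auto simp: self_avoiding_bridge_def)
    have "bridge d xs"
      using L heights[OF xs(3)] xs(2) unfolding self_avoiding_bridge_def bridge_def xs(1) by blast
    thus "\<exists>xs. \<omega> = 0 # xs \<and> bridge d xs \<and> length xs = n" using xs by blast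
  next
    assume "\<exists>xs. \<omega> = 0 # xs \<and> bridge d xs \<and> length xs = n"
    then obtain xs where xs: "\<omega> = 0 # xs" "bridge d xs" "length xs = n"
      by blast
    hence "self_avoiding_walk d n \<omega> \<and> hd \<omega> = origin"
      using walk_from_origin_iff[of d n \<omega>] by (auto simp: bridge_def)
    thus "self_avoiding_bridge d n \<omega> \<and> hd \<omega> = origin"
      using heights[OF xs(3)] xs(2) unfolding self_avoiding_bridge_def bridge_def xs(1) by blast
  qed
qed

lemma saw_count_eq: "saw_count d n = card {xs. saw d xs \<and> length xs = n}"
proof -
  have "{\<omega>. self_avoiding_walk d n \<omega> \<and> hd \<omega> = origin} = (#) 0 ` {xs. saw d xs \<and> length xs = n}"
    unfolding walk_from_origin_iff by auto
  thus ?thesis by (simp add: saw_count_def card_image)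
qed

lemma sab_count_eq: "sab_count d n = card {xs. bridge d xs \<and> length xs = n}"
proof -
  have "{\<omega>. self_avoiding_bridge d n \<omega> \<and> hd \<omega> = origin} = (#) 0 ` {xs. bridge d xs \<and> length xs = n}"
    unfolding bridge_from_origin_iff by auto
  thus ?thesis by (simp add: sab_count_def card_image)
qed

definition up :: "nat \<Rightarrow> vertex" where
  "up d = 0(d := 1)"

lemma up_lattice: "1 \<le> d \<Longrightarrow> up d \<in> lattice d"
  by (auto simp: up_def lattice_def)

lemma up_d [simp]: "up d d = 1"
  by (simp add: up_def)

lemma adjacent_0_up: "1 \<le> d \<Longrightarrow> adjacent d 0 (up d)"
proof -
  assume d: "1 \<le> d"
  have "(\<Sum>i=1..d. \<bar>(0::vertex) i - up d i\<bar>) = (\<Sum>i=1..d. if i = d then 1 else 0)"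
    by (intro sum.cong) (auto simp: up_def)
  also have "\<dots> = (1::int)"
    using d by simp
  finally show ?thesis by (simp add: adjacent_def)
qed

lemma sab_count_mult_le: "sab_count d m * sab_count d n \<le> sab_count d (m + n)"
proof -
  let ?B = "\<lambda>n. {xs. bridge d xs \<and> length xs = n}"
  have "inj_on (\<lambda>(xs, ys). join xs ys) (?B m \<times> ?B n)"
    by (rule inj_onI) (auto dest: join_inject_length)
  moreover have "(\<lambda>(xs, ys). join xs ys) ` (?B m \<times> ?B n) \<subseteq> ?B (m + n)"
    by (auto intro: bridge_join)
  moreover have "finite (?B (m + n))"
    by (rule finite_bridges_of_length)
  ultimately have "card (?B m \<times> ?B n) \<le> card (?B (m + n))"
    by (rule card_inj_on_le)
  thus ?thesis by (simp add: sab_count_eq card_cartesian_product)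
qed

lemma sab_count_power_le: "sab_count d n ^ k \<le> sab_count d (k * n)"
proof (induction k)
  case 0
  have "{xs. bridge d xs \<and> length xs = 0} = {[]}" by (auto simp: bridge_def saw_def)
  thus ?case by (simp add: sab_count_eq)
next
  case (Suc k)
  have "sab_count d n ^ Suc k \<le> sab_count d n * sab_count d (k * n)"
    using Suc by simp
  also have "\<dots> \<le> sab_count d (n + k * n)" by (rule sab_count_mult_le)
  finally show ?case by simp
qed

text \<open>
  The vertical straight walk is a bridge.
\<close>

lemma sab_count_pos:
  assumes d: "1 \<le> d"
  shows "1 \<le> sab_count d n"
proof -
  have "bridge d [up d]"
    using adjacent_0_up[OF d] up_lattice[OF d] up_d[of d]
    by (auto simp: bridge_def saw_def endpoint_def simp del: up_d)
  hence "{xs. bridge d xs \<and> length xs = 1} \<noteq> {}" by (auto intro!: exI[of _ "[up d]"])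
  moreover have "finite {xs. bridge d xs \<and> length xs = 1}"
    by (rule finite_bridges_of_length)
  ultimately have "1 \<le> sab_count d 1"
    unfolding sab_count_eq by (simp add: Suc_le_eq card_gt_0_iff)
  hence "1 \<le> sab_count d 1 ^ n" by simp
  also have "\<dots> \<le> sab_count d n" using sab_count_power_le[of d 1 n] by simp
  finally show ?thesis .
qed

lemma sab_count_le_saw_count: "sab_count d n \<le> saw_count d n"
  unfolding sab_count_eq saw_count_eq
  by (intro card_mono finite_saw_subset[of _ d n]) (auto simp: bridge_def)

lemma saw_count_add_le: "saw_count d (m + n) \<le> saw_count d m * saw_count d n"
proof -
  let ?C = "\<lambda>n. {xs. saw d xs \<and> length xs = n}"
  have "?C (m + n) \<subseteq> (\<lambda>(xs, ys). join xs ys) ` (?C m \<times> ?C n)"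
  proof safe
    fix xs assume xs: "saw d xs" "length xs = m + n"
    let ?ys = "map (\<lambda>x. x - endpoint (take m xs)) (drop m xs)"
    have j: "xs = join (take m xs) ?ys"
      using split_join[of "take m xs" "drop m xs"] by simp
    have "saw d (take m xs)" "saw d ?ys"
      using xs(1) by (subst (asm) j, simp add: saw_join_iff)+
    thus "xs \<in> (\<lambda>(xs, ys). join xs ys) ` (?C m \<times> ?C n)"
      using xs j by (intro image_eqI[of _ _ "(take m xs, ?ys)"]) auto
  qed
  moreover have "finite (?C m \<times> ?C n)"
    by (intro finite_cartesian_product finite_saw_subset[of _ d m] finite_saw_subset[of _ d n]) auto
  ultimately have "card (?C (m + n)) \<le> card (?C m \<times> ?C n)"
    by (rule surj_card_le[rotated])
  thus ?thesis by (simp add: saw_count_eq card_cartesian_product)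
qed

section \<open>The connective constant\<close>

text \<open>
  Fekete's lemma: division with remainder by a \<open>k\<close> for which $u_k / k$ is nearly minimal
  shows that $u_n / n$ is at most $u_k / k + O(1/n)$.
\<close>

lemma subadditive_convergent:
  fixes u :: "nat \<Rightarrow> real"
  assumes sub: "\<And>m n. u (m + n) \<le> u m + u n" and nonneg: "\<And>n. 0 \<le> u n"
  shows "convergent (\<lambda>n. u n / real n)"
proof -
  define L where "L = (INF n\<in>{1..}. u n / real n)"
  have bdd: "bdd_below ((\<lambda>n. u n / real n) ` {1..})"
    using nonneg by (intro bdd_belowI2[of _ 0]) simp
  have lower: "L \<le> u n / real n" if "n \<ge> 1" for n
    unfolding L_def using that by (intro cINF_lower[OF bdd]) auto
  have mult: "u (q * k + r) \<le> real q * u k + u r" for q k r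
  proof (induction q)
    case (Suc q)
    have "u (Suc q * k + r) \<le> u k + u (q * k + r)"
      using sub[of k "q * k + r"] by (simp add: algebra_simps)
    thus ?case using Suc by (simp add: algebra_simps)
  qed simp
  have "(\<lambda>n. u n / real n) \<longlonglongrightarrow> L"
  proof (rule LIMSEQ_I)
    fix e :: real assume e: "0 < e"
    obtain k where k: "k \<ge> 1" "u k / real k < L + e / 2"
      using cINF_less_iff[OF _ bdd, of "L + e / 2"] e by (auto simp: L_def)
    define M where "M = (\<Sum>r<k. u r)"
    have M: "u r \<le> M" if "r < k" for r
      unfolding M_def using that nonneg by (intro member_le_sum) auto
    obtain n0 where n0: "2 * M / e < real n0"
      using reals_Archimedean2 by blast
    show "\<exists>no. \<forall>n\<ge>no. norm (u n / real n - L) < e"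
    proof (intro exI allI impI)
      fix n assume n: "n \<ge> max n0 1"
      have "u n \<le> real (n div k) * u k + u (n mod k)"
        using mult[of "n div k" k "n mod k"] by simp
      also have "real (n div k) * u k \<le> real n / real k * u k"
        using nonneg by (intro mult_right_mono of_nat_div_le_of_nat) auto
      also have "u (n mod k) \<le> M" using k by (intro M) simp
      finally have "u n / real n \<le> u k / real k + M / real n"
        using n k by (simp add: field_simps)
      moreover have "M / real n < e / 2"
      proof -
        have "2 * M / e < real n" using n n0 by simp
        thus ?thesis using e n by (simp add: field_simps)
      qed
      ultimately show "norm (u n / real n - L) < e"
        using k(2) lower[of n] n unfolding real_norm_def abs_less_iff by linarith
    qed
  qed
  thus ?thesis by (rule convergentI)
qed

lemma submultiplicative_root_convergent:
  fixes c :: "nat \<Rightarrow> real"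
  assumes "\<And>m n. c (m + n) \<le> c m * c n" and one: "\<And>n. 1 \<le> c n"
  shows "convergent (\<lambda>n. c n powr (1 / real n))"
proof -
  have pos: "0 < c n" for n using one[of n] by simp
  have "convergent (\<lambda>n. ln (c n) / real n)"
  proof (rule subadditive_convergent)
    fix m n
    have "ln (c (m + n)) \<le> ln (c m * c n)"
      using assms(1) pos by simp
    thus "ln (c (m + n)) \<le> ln (c m) + ln (c n)"
      using pos[of m] pos[of n] by (simp add: ln_mult)
  qed (use one in simp)
  then obtain L where "(\<lambda>n. ln (c n) / real n) \<longlonglongrightarrow> L" by (auto simp: convergent_def)
  hence "(\<lambda>n. exp (ln (c n) / real n)) \<longlonglongrightarrow> exp L" by (rule tendsto_exp)
  moreover have "exp (ln (c n) / real n) = c n powr (1 / real n)" for n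
    using pos[of n] by (simp add: powr_def)
  ultimately show ?thesis by (auto simp: convergent_def)
qed

lemma connective_constant_LIMSEQ:
  assumes "1 \<le> d"
  shows "(\<lambda>n. real (saw_count d n) powr (1 / real n)) \<longlonglongrightarrow> connective_constant d"
proof -
  have "1 \<le> saw_count d n" for n
    using sab_count_pos[OF assms, of n] sab_count_le_saw_count[of d n] by linarith
  moreover have "real (saw_count d (m + n)) \<le> real (saw_count d m) * real (saw_count d n)" for m n
    using saw_count_add_le[of d m n] by (simp flip: of_nat_mult)
  ultimately have "convergent (\<lambda>n. real (saw_count d n) powr (1 / real n))"
    by (intro submultiplicative_root_convergent) simp_all
  thus ?thesis by (simp add: convergent_LIMSEQ_iff connective_constant_def)
qed

text \<open>
  By supermultiplicativity, $b_n^{1/n} \le b_{kn}^{1/(kn)} \le c_{kn}^{1/(kn)}$ for every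
  $k \ge 1$, and the right-hand side tends to $\mu$ as $k$ grows.
\<close>

lemma root_sab_count_le_connective_constant:
  assumes d: "1 \<le> d" and n: "1 \<le> n"
  shows "real (sab_count d n) powr (1 / real n) \<le> connective_constant d"
proof (rule LIMSEQ_le_const)
  have "strict_mono (\<lambda>k. Suc k * n)"
    using n by (intro strict_monoI) simp
  thus "(\<lambda>k. real (saw_count d (Suc k * n)) powr (1 / real (Suc k * n))) \<longlonglongrightarrow> connective_constant d"
    by (rule LIMSEQ_subseq_LIMSEQ[OF connective_constant_LIMSEQ[OF d], unfolded comp_def])
next
  have "real (sab_count d n) powr (1 / real n) \<le> real (saw_count d (Suc k * n)) powr (1 / real (Suc k * n))" for k
  proof -
    have b: "1 \<le> real (sab_count d n)" using sab_count_pos[OF d, of n] by simp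
    have "sab_count d n ^ Suc k \<le> saw_count d (Suc k * n)"
      using sab_count_power_le[of d n "Suc k"] sab_count_le_saw_count[of d "Suc k * n"] by linarith
    hence "(real (sab_count d n) ^ Suc k) powr (1 / real (Suc k * n))
        \<le> real (saw_count d (Suc k * n)) powr (1 / real (Suc k * n))"
      by (intro powr_mono2) (simp_all flip: of_nat_power of_nat_mult)
    also have "real (sab_count d n) ^ Suc k = real (sab_count d n) powr real (Suc k)"
      using b by (subst powr_realpow) auto
    finally have "real (sab_count d n) powr (real (Suc k) * (1 / real (Suc k * n)))
        \<le> real (saw_count d (Suc k * n)) powr (1 / real (Suc k * n))"
      by (simp only: powr_powr)
    moreover have "real (Suc k) * (1 / real (Suc k * n)) = 1 / real n"
      by (simp only: of_nat_mult) simp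
    ultimately show ?thesis by simp
  qed
  thus "\<exists>N. \<forall>k\<ge>N. real (sab_count d n) powr (1 / real n)
      \<le> real (saw_count d (Suc k * n)) powr (1 / real (Suc k * n))"
    by blast
qed

lemma connective_constant_ge_1:
  assumes "1 \<le> d"
  shows "1 \<le> connective_constant d"
  using root_sab_count_le_connective_constant[OF assms, of 1] sab_count_pos[OF assms, of 1] by simp

lemma sab_count_le_connective_constant_power:
  assumes d: "1 \<le> d"
  shows "real (sab_count d n) \<le> connective_constant d ^ n"
proof (cases "n = 0")
  case True
  have "{xs. bridge d xs \<and> length xs = 0} = {[]}" by (auto simp: bridge_def saw_def)
  thus ?thesis using True by (simp add: sab_count_eq)
next
  case False
  have "0 < sab_count d n" using sab_count_pos[OF d, of n] by simp
  hence "real (sab_count d n) = (real (sab_count d n) powr (1 / real n)) ^ n"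
    using False by (simp add: powr_powr flip: powr_realpow)
  also have "\<dots> \<le> connective_constant d ^ n"
    using False by (intro power_mono root_sab_count_le_connective_constant[OF d]) auto
  finally show ?thesis .
qed

section \<open>Truncated generating functions\<close>

definition bridges :: "nat \<Rightarrow> nat \<Rightarrow> vertex list set" where
  "bridges d m = {xs. bridge d xs \<and> endpoint xs d = int m}"

definition half_space_walks :: "nat \<Rightarrow> nat \<Rightarrow> vertex list set" where
  "half_space_walks d A = {xs. saw d xs \<and> (\<forall>x\<in>set xs. 0 < x d \<and> x d \<le> int A)}"

text \<open>
  Only walks of length at most \<open>N\<close> are counted, which makes the sum finite for every \<open>z\<close>.
\<close>

definition gf :: "vertex list set \<Rightarrow> nat \<Rightarrow> real \<Rightarrow> real" where
  "gf S N z = (\<Sum>xs | xs \<in> S \<and> length xs \<le> N. z ^ length xs)"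

lemma finite_gf_index:
  "S \<subseteq> {xs. saw d xs} \<Longrightarrow> finite {xs. xs \<in> S \<and> length xs \<le> N}"
  by (rule finite_subset[OF _ finite_saw[of d N]]) auto

lemma bridges_saw: "bridges d m \<subseteq> {xs. saw d xs}"
  by (auto simp: bridges_def bridge_def)

lemma half_space_walks_saw: "half_space_walks d A \<subseteq> {xs. saw d xs}"
  by (auto simp: half_space_walks_def)

lemma gf_nonneg: "0 \<le> z \<Longrightarrow> 0 \<le> gf S N z"
  by (simp add: gf_def sum_nonneg)

lemma gf_eq_sum_card:
  assumes "S \<subseteq> {xs. saw d xs}"
  shows "gf S N z = (\<Sum>n\<le>N. real (card {xs. xs \<in> S \<and> length xs = n}) * z ^ n)"
proof -
  let ?T = "{xs. xs \<in> S \<and> length xs \<le> N}"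
  have "gf S N z = (\<Sum>n\<le>N. \<Sum>xs | xs \<in> ?T \<and> length xs = n. z ^ length xs)"
    unfolding gf_def using finite_gf_index[OF assms] by (intro sum.group[symmetric]) auto
  also have "\<dots> = (\<Sum>n\<le>N. real (card {xs. xs \<in> S \<and> length xs = n}) * z ^ n)"
  proof (intro sum.cong refl)
    fix n assume "n \<in> {..N}"
    hence "{xs. xs \<in> ?T \<and> length xs = n} = {xs. xs \<in> S \<and> length xs = n}" by auto
    thus "(\<Sum>xs | xs \<in> ?T \<and> length xs = n. z ^ length xs)
        = real (card {xs. xs \<in> S \<and> length xs = n}) * z ^ n"
      by simp
  qed
  finally show ?thesis .
qed

text \<open>
  In contrast to the bounds on half-space walks, injectivity matters here: the products on the left
  are the weights of distinct bridges on the right.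
\<close>

lemma gf_bridges_mult_le:
  assumes z: "0 \<le> z"
  shows "gf (bridges d m) M z * gf (bridges d n) N z \<le> gf (bridges d (m + n)) (M + N) z"
proof -
  let ?B = "\<lambda>m M. {xs. xs \<in> bridges d m \<and> length xs \<le> M}"
  let ?f = "\<lambda>(xs, ys). join xs ys"
  let ?w = "\<lambda>xs :: vertex list. z ^ length xs"
  have inj: "inj_on ?f (?B m M \<times> ?B n N)"
    by (rule inj_onI) (auto simp: bridges_def dest: join_inject_height)
  have "gf (bridges d m) M z * gf (bridges d n) N z = sum (?w \<circ> ?f) (?B m M \<times> ?B n N)"
    unfolding gf_def sum_product sum.cartesian_product by (intro sum.cong) (auto simp: power_add)
  also have "\<dots> = sum ?w (?f ` (?B m M \<times> ?B n N))"
    by (rule sum.reindex[OF inj, symmetric])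
  also have "\<dots> \<le> gf (bridges d (m + n)) (M + N) z"
    unfolding gf_def
  proof (rule sum_mono2)
    show "finite (?B (m + n) (M + N))" by (rule finite_gf_index[OF bridges_saw])
  qed (use z in \<open>auto simp: bridges_def endpoint_join intro: bridge_join\<close>)
  finally show ?thesis .
qed

lemma gf_bridges_power_le:
  assumes z: "0 \<le> z"
  shows "gf (bridges d m) N z ^ k \<le> gf (bridges d (k * m)) (k * N) z"
proof (induction k)
  case 0
  have "[] \<in> bridges d 0" by (simp add: bridges_def bridge_def saw_def)
  hence "{xs. xs \<in> bridges d 0 \<and> length xs \<le> 0} = {[]}" by auto
  thus ?case by (simp add: gf_def)
next
  case (Suc k)
  have "gf (bridges d m) N z ^ Suc k \<le> gf (bridges d m) N z * gf (bridges d (k * m)) (k * N) z"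
    using Suc gf_nonneg[OF z] by (simp add: mult_left_mono)
  also have "\<dots> \<le> gf (bridges d (m + k * m)) (N + k * N) z"
    by (rule gf_bridges_mult_le[OF z])
  finally show ?case by simp
qed

section \<open>Unfolding half-space walks into bridges\<close>

definition reflect :: "nat \<Rightarrow> vertex \<Rightarrow> vertex" where
  "reflect d x = x(d := - x d)"

lemma reflect_reflect [simp]: "reflect d (reflect d x) = x"
  by (simp add: reflect_def)

lemma adjacent_reflect [simp]: "adjacent d (reflect d x) (reflect d y) \<longleftrightarrow> adjacent d x y"
proof -
  have "(\<Sum>i=1..d. \<bar>reflect d x i - reflect d y i\<bar>) = (\<Sum>i=1..d. \<bar>x i - y i\<bar>)"
    by (intro sum.cong) (auto simp: reflect_def)
  thus ?thesis by (simp add: adjacent_def)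
qed

lemma inj_reflect: "inj (reflect d)"
  by (metis injI reflect_reflect)

lemma saw_reflect:
  assumes "saw d xs"
  shows "saw d (map (reflect d) xs)"
proof -
  have r0: "reflect d 0 = 0" by (simp add: reflect_def fun_eq_iff)
  have "successively (adjacent d) (map (reflect d) (0 # xs))"
    using assms by (simp only: successively_map adjacent_reflect saw_def)
  moreover have "distinct (map (reflect d) (0 # xs))"
    using assms inj_on_subset[OF inj_reflect subset_UNIV] by (simp only: distinct_map saw_def)
  moreover have "reflect d x \<in> lattice d" if "x \<in> lattice d" for x
    using that by (auto simp: lattice_def reflect_def)
  ultimately show ?thesis
    using assms by (auto simp: saw_def r0)
qed

text \<open>
  Cuts a walk at its last vertex, possibly the origin itself, with a given property. This one cut
  serves both decompositions, at the highest and at the lowest level.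
\<close>

lemma split_at_last:
  assumes "\<exists>x\<in>set (0 # xs). P x"
  obtains ys zs where "xs = ys @ zs" "P (endpoint ys)" "\<forall>z\<in>set zs. \<not> P z"
proof -
  obtain us x zs where s: "0 # xs = us @ x # zs" "P x" "\<forall>z\<in>set zs. \<not> P z"
    using split_list_last_prop[OF assms] by blast
  show thesis
  proof (cases us)
    case Nil
    thus thesis using s that[of "[]" zs] by simp
  next
    case (Cons u vs)
    thus thesis using s that[of "vs @ [x]" zs] by simp
  qed
qed

text \<open>
  The cut is at the last vertex of maximal height. After it the walk has heights between \<open>1\<close> and
  \<open>A\<close>, so that after reflection its depths below the cut are again between \<open>1\<close> and \<open>A\<close>.
\<close>

lemma half_space_walk_unfold:
  assumes xs: "xs \<in> half_space_walks d (Suc A)" "xs \<notin> half_space_walks d A"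
  obtains ys zs where "ys \<in> bridges d (Suc A)" "zs \<in> half_space_walks d A"
    "xs = join ys (map (reflect d) zs)"
proof -
  have saw: "saw d xs" and h: "\<And>x. x \<in> set xs \<Longrightarrow> 0 < x d \<and> x d \<le> int (Suc A)"
    using xs(1) by (auto simp: half_space_walks_def)
  have "\<exists>x\<in>set (0 # xs). x d = int (Suc A)"
  proof (rule ccontr)
    assume no: "\<not> (\<exists>x\<in>set (0 # xs). x d = int (Suc A))"
    have "x d \<le> int A" if "x \<in> set xs" for x
      using no h[OF that] that by (cases "x d = int (Suc A)") auto
    thus False using xs(2) saw h by (auto simp: half_space_walks_def)
  qed
  then obtain ys us where s: "xs = ys @ us" "endpoint ys d = int (Suc A)"
      "\<forall>z\<in>set us. z d \<noteq> int (Suc A)"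
    by (rule split_at_last)
  define zs where "zs = map (\<lambda>x. reflect d (x - endpoint ys)) us"
  have j: "xs = join ys (map (\<lambda>x. x - endpoint ys) us)"
    using s(1) by (simp add: split_join)
  have "saw d ys" "saw d (map (\<lambda>x. x - endpoint ys) us)"
    using saw unfolding j saw_join_iff by auto
  hence "saw d ys" "saw d zs"
    using saw_reflect[of d "map (\<lambda>x. x - endpoint ys) us"] by (simp_all add: zs_def comp_def)
  moreover have "0 < z d \<and> z d \<le> int A" if "z \<in> set zs" for z
  proof -
    obtain x where x: "x \<in> set us" "z = reflect d (x - endpoint ys)"
      using \<open>z \<in> set zs\<close> by (auto simp: zs_def)
    have "0 < x d" "x d \<le> int (Suc A)" "x d \<noteq> int (Suc A)"
      using x(1) h[of x] s by auto
    thus ?thesis using x(2) s(2) by (simp add: reflect_def)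
  qed
  ultimately have "zs \<in> half_space_walks d A" "ys \<in> bridges d (Suc A)"
    using s h by (auto simp: half_space_walks_def bridges_def bridge_def)
  moreover have "xs = join ys (map (reflect d) zs)"
    unfolding j zs_def by (simp add: comp_def)
  ultimately show thesis using that by blast
qed

text \<open>
  Every walk of maximal height \<open>Suc A\<close> is obtained from some pair of a bridge and a lower
  half-space walk, and its weight is the product of theirs. Surjectivity suffices for the upper
  bound: pairs that do not come from a half-space walk only increase the right-hand side.
\<close>

lemma gf_half_space_walks_Suc:
  assumes z: "0 \<le> z"
  shows "gf (half_space_walks d (Suc A)) N z
    \<le> (1 + gf (bridges d (Suc A)) N z) * gf (half_space_walks d A) N z"
proof -
  let ?H = "\<lambda>A. {xs. xs \<in> half_space_walks d A \<and> length xs \<le> N}"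
  let ?B = "{xs. xs \<in> bridges d (Suc A) \<and> length xs \<le> N}"
  let ?f = "\<lambda>(ys, zs). join ys (map (reflect d) zs)"
  let ?w = "\<lambda>xs :: vertex list. z ^ length xs"
  have fin: "finite (?H A)" "finite (?H (Suc A))" "finite ?B"
    using finite_gf_index[OF half_space_walks_saw] finite_gf_index[OF bridges_saw] by auto
  have "?H (Suc A) \<subseteq> ?H A \<union> ?f ` (?B \<times> ?H A)"
  proof
    fix xs assume xs: "xs \<in> ?H (Suc A)"
    show "xs \<in> ?H A \<union> ?f ` (?B \<times> ?H A)"
    proof (cases "xs \<in> half_space_walks d A")
      case False
      then obtain ys zs where "ys \<in> bridges d (Suc A)" "zs \<in> half_space_walks d A"
          "xs = join ys (map (reflect d) zs)"
        using xs half_space_walk_unfold by blast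
      thus ?thesis using xs by force
    qed (use xs in simp)
  qed
  hence "gf (half_space_walks d (Suc A)) N z \<le> sum ?w (?H A \<union> ?f ` (?B \<times> ?H A))"
    unfolding gf_def using fin z by (intro sum_mono2) auto
  also have "\<dots> \<le> sum ?w (?H A) + sum ?w (?f ` (?B \<times> ?H A))"
    using fin z sum.union_inter[of "?H A" "?f ` (?B \<times> ?H A)" ?w]
      sum_nonneg[of "?H A \<inter> ?f ` (?B \<times> ?H A)" ?w] by simp
  also have "sum ?w (?f ` (?B \<times> ?H A)) \<le> sum (?w \<circ> ?f) (?B \<times> ?H A)"
    using fin z by (intro sum_image_le) auto
  also have "sum (?w \<circ> ?f) (?B \<times> ?H A) = gf (bridges d (Suc A)) N z * gf (half_space_walks d A) N z"
    unfolding gf_def sum_product sum.cartesian_product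
    by (intro sum.cong) (auto simp: power_add)
  finally show ?thesis by (simp add: gf_def algebra_simps)
qed

lemma gf_half_space_walks_le:
  assumes z: "0 \<le> z"
  shows "gf (half_space_walks d A) N z \<le> (\<Prod>m=1..A. 1 + gf (bridges d m) N z)"
proof (induction A)
  case 0
  have "half_space_walks d 0 = {[]}"
  proof -
    have "xs = []" if "xs \<in> half_space_walks d 0" for xs
      using that by (cases xs) (auto simp: half_space_walks_def)
    thus ?thesis by (auto simp: half_space_walks_def saw_def)
  qed
  moreover have "{xs. xs \<in> {[]} \<and> length xs \<le> N} = {[] :: vertex list}" by auto
  ultimately show ?case by (simp add: gf_def)
next
  case (Suc A)
  have "gf (half_space_walks d (Suc A)) N z
      \<le> (1 + gf (bridges d (Suc A)) N z) * gf (half_space_walks d A) N z"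
    by (rule gf_half_space_walks_Suc[OF z])
  also have "\<dots> \<le> (1 + gf (bridges d (Suc A)) N z) * (\<Prod>m=1..A. 1 + gf (bridges d m) N z)"
    using Suc gf_nonneg[OF z] by (intro mult_left_mono) (auto intro: add_nonneg_nonneg)
  finally show ?case by (simp add: mult.commute)
qed

section \<open>Splitting a walk at its lowest level\<close>

text \<open>
  The vertical step in front of the reversed initial part \<open>us\<close> is needed because the minimal
  height may have been attained several times before the cut: it makes the start strictly lower
  than all other vertices. The last vertex of \<open>us\<close> is the image of the origin under the
  translation used, which is why \<open>us\<close> alone determines the initial part of the walk.
\<close>

lemma saw_split_at_minimum:
  assumes d: "1 \<le> d" and saw: "saw d xs" and len: "length xs = n"
  obtains us ws where "us \<in> half_space_walks d (Suc n)" "ws \<in> half_space_walks d (Suc n)"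
    "length us + length ws = Suc n" "xs = join (tl (rev (map (\<lambda>x. x - last us) us))) ws"
proof -
  define m where "m = Min ((\<lambda>x. x d) ` set (0 # xs))"
  have m: "m \<le> x d" if "x \<in> set (0 # xs)" for x
    using that unfolding m_def by (intro Min_le) auto
  have "m \<in> (\<lambda>x. x d) ` set (0 # xs)"
    unfolding m_def by (intro Min_in) auto
  hence "\<exists>x\<in>set (0 # xs). x d = m" by auto
  then obtain ys zs where s: "xs = ys @ zs" "endpoint ys d = m" "\<forall>z\<in>set zs. z d \<noteq> m"
    by (rule split_at_last)
  define v where "v = endpoint ys"
  define us where "us = map ((+) (up d - v)) (rev (0 # ys))"
  define ws where "ws = map (\<lambda>x. x - v) zs"
  have j: "xs = join ys ws"
    using s(1) by (simp add: split_join ws_def v_def)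
  have saws: "saw d ys" "saw d ws"
    using saw unfolding j saw_join_iff by auto
  have v: "v \<in> lattice d"
    using saw_endpoint_lattice[OF saws(1)] by (simp add: v_def)
  have us_pos: "0 < x d" if "x \<in> set us" for x
    using that m s(1,2) by (force simp: us_def v_def)
  have ws_pos: "0 < x d" if "x \<in> set ws" for x
  proof -
    obtain y where y: "y \<in> set zs" "x = y - v" using \<open>x \<in> set ws\<close> by (auto simp: ws_def)
    have "m \<le> y d" "y d \<noteq> m" using y(1) s(1,3) m[of y] by auto
    thus ?thesis using y(2) s(2) by (simp add: v_def)
  qed
  have saw_us: "saw d us"
  proof -
    have "set us \<subseteq> lattice d"
      using saws(1) lattice_add_iff[OF lattice_diff[OF up_lattice[OF d] v]]
        lattice_diff[OF up_lattice[OF d] v]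
      by (auto simp: us_def saw_def)
    moreover have "hd us = up d" "us \<noteq> []"
      by (simp_all add: us_def hd_map hd_rev v_def endpoint_def del: rev.simps last.simps)
    hence "successively (adjacent d) (0 # us)"
      using saws(1) adjacent_0_up[OF d]
      by (simp add: successively_Cons)
         (simp add: us_def successively_translate saw_def adjacent_commute del: rev.simps map_append list.map)
    moreover have "distinct us"
      using saws(1) by (auto simp: us_def distinct_map saw_def)
    moreover have "0 \<notin> set us"
      using us_pos by force
    ultimately show ?thesis by (simp add: saw_def)
  qed
  have len': "length us + length ws = Suc n"
    using len s(1) by (simp add: us_def ws_def)
  have bound: "x d \<le> int (Suc n)" if "saw d as" "length as \<le> Suc n" "x \<in> set as" for as x
    using saw_bounded[OF that(1,3), of d] that(2) by linarith
  from saw_us have "us \<in> half_space_walks d (Suc n)"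
    using us_pos len' bound[of us] by (simp add: half_space_walks_def)
  moreover have "ws \<in> half_space_walks d (Suc n)"
    using saws(2) ws_pos len' bound[of ws] by (simp add: half_space_walks_def)
  moreover have "tl (rev (map (\<lambda>x. x - last us) us)) = ys"
  proof -
    have "last us = up d - v" by (simp add: us_def)
    thus ?thesis by (simp add: us_def rev_map comp_def del: rev.simps)
  qed
  ultimately show thesis using that j len' by metis
qed

text \<open>
  The exponent \<open>n + 1\<close> accounts for the extra vertical step. A walk is at most as high as it is
  long, so the height bound \<open>Suc n\<close> excludes no half-space walk of length at most \<open>Suc n\<close>.
\<close>

lemma saw_count_le_half_space_walks:
  assumes d: "1 \<le> d" and z: "0 \<le> z"
  shows "real (saw_count d n) * z ^ (n + 1) \<le> (gf (half_space_walks d (Suc n)) (Suc n) z)\<^sup>2"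
proof -
  let ?H = "{xs. xs \<in> half_space_walks d (Suc n) \<and> length xs \<le> Suc n}"
  let ?P = "{(us, ws). us \<in> ?H \<and> ws \<in> ?H \<and> length us + length ws = Suc n}"
  let ?f = "\<lambda>(us, ws). join (tl (rev (map (\<lambda>x. x - last us) us))) ws"
  have fin: "finite ?H" by (rule finite_gf_index[OF half_space_walks_saw])
  have finP: "finite ?P" by (rule finite_subset[of _ "?H \<times> ?H"]) (use fin in auto)
  have "{xs. saw d xs \<and> length xs = n} \<subseteq> ?f ` ?P"
  proof
    fix xs assume "xs \<in> {xs. saw d xs \<and> length xs = n}"
    then obtain us ws where "us \<in> half_space_walks d (Suc n)" "ws \<in> half_space_walks d (Suc n)"
      "length us + length ws = Suc n" "xs = join (tl (rev (map (\<lambda>x. x - last us) us))) ws"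
      using saw_split_at_minimum[OF d, of xs n] by auto
    thus "xs \<in> ?f ` ?P" by force
  qed
  hence "saw_count d n \<le> card ?P"
    unfolding saw_count_eq by (rule surj_card_le[OF finP])
  hence "real (saw_count d n) * z ^ (n + 1) \<le> real (card ?P) * z ^ (n + 1)"
    using z by (intro mult_right_mono) auto
  also have "\<dots> = (\<Sum>(us, ws)\<in>?P. z ^ length us * z ^ length ws)"
    by (subst sum_constant[symmetric], rule sum.cong) (auto simp flip: power_add)
  also have "\<dots> \<le> (\<Sum>(us, ws)\<in>?H \<times> ?H. z ^ length us * z ^ length ws)"
    using fin z by (intro sum_mono2) auto
  also have "\<dots> = (gf (half_space_walks d (Suc n)) (Suc n) z)\<^sup>2"
    by (simp add: gf_def power2_eq_square sum_product sum.cartesian_product)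
  finally show ?thesis .
qed

section \<open>Exponential decay of the bridge generating function\<close>

lemma card_bridges_le_sab_count:
  "card {xs. xs \<in> bridges d m \<and> length xs = n} \<le> sab_count d n"
  unfolding sab_count_eq
  by (intro card_mono finite_bridges_of_length) (auto simp: bridges_def)

lemma card_bridges_le_card_tall:
  "card {xs. xs \<in> bridges d m \<and> length xs = n}
    \<le> card {\<omega>. self_avoiding_bridge d n \<omega> \<and> goes_from_to \<omega> origin (upper_half_space d m)}"
proof -
  have fin: "finite {\<omega>. self_avoiding_bridge d n \<omega> \<and> hd \<omega> = origin}"
  proof -
    have "{\<omega>. self_avoiding_bridge d n \<omega> \<and> hd \<omega> = origin} = (#) 0 ` {xs. bridge d xs \<and> length xs = n}"
      unfolding bridge_from_origin_iff by auto
    moreover have "finite {xs. bridge d xs \<and> length xs = n}"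
      by (rule finite_bridges_of_length)
    ultimately show ?thesis by simp
  qed
  have "(#) 0 ` {xs. xs \<in> bridges d m \<and> length xs = n}
      \<subseteq> {\<omega>. self_avoiding_bridge d n \<omega> \<and> goes_from_to \<omega> origin (upper_half_space d m)}"
  proof clarify
    fix xs assume xs: "xs \<in> bridges d m" "n = length xs"
    have "self_avoiding_bridge d n (0 # xs) \<and> hd (0 # xs) = origin"
      unfolding bridge_from_origin_iff using xs by (auto simp: bridges_def)
    moreover have "last (0 # xs) \<in> upper_half_space d m"
      unfolding endpoint_def[symmetric] using xs(1) saw_endpoint_lattice[of d xs]
      by (auto simp: bridges_def bridge_def upper_half_space_def)
    ultimately show "self_avoiding_bridge d (length xs) (0 # xs)
        \<and> goes_from_to (0 # xs) origin (upper_half_space d m)"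
      using xs(2) by (simp add: goes_from_to_def del: last.simps)
  qed
  thus ?thesis
    by (rule card_inj_on_le[rotated]) (auto intro: finite_subset[OF _ fin] simp: goes_from_to_def)
qed

lemma bridges_height_le_length: "xs \<in> bridges d m \<Longrightarrow> m \<le> length xs"
  using saw_bounded[of d xs "endpoint xs" d] endpoint_in[of xs]
  by (auto simp: bridges_def bridge_def)

text \<open>
  A factor of linear growth is invisible to \<open>k\<close>-th roots: $(Ck + 1) (b/a)^k$ tends to \<open>0\<close> if
  $b < a$.
\<close>

lemma le_of_power_le_linear:
  fixes a b :: real
  assumes "0 \<le> a" "0 \<le> b" and pow: "\<And>k. a ^ k \<le> (real k * C + 1) * b ^ k"
  shows "a \<le> b"
proof (rule ccontr)
  assume "\<not> a \<le> b"
  hence ab: "b < a" by simp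
  hence a: "0 < a" using assms by simp
  define r where "r = b / a"
  have r: "0 \<le> r" "r < 1" using ab a assms by (auto simp: r_def)
  have "(\<lambda>k. real k * r ^ k) \<longlonglongrightarrow> 0"
    using r powser_times_n_limit_0[of r] by simp
  moreover have "(\<lambda>k. r ^ k) \<longlonglongrightarrow> 0"
    using r by (intro LIMSEQ_realpow_zero)
  ultimately have "(\<lambda>k. C * (real k * r ^ k) + r ^ k) \<longlonglongrightarrow> C * 0 + 0"
    by (intro tendsto_add tendsto_mult tendsto_const)
  moreover have "1 \<le> C * (real k * r ^ k) + r ^ k" for k
    using pow[of k] a by (simp add: r_def power_divide field_simps)
  ultimately have "1 \<le> C * 0 + 0"
    by (intro LIMSEQ_le_const) auto
  thus False by simp
qed

abbreviation psi_set :: "(real \<Rightarrow> real) \<Rightarrow> real \<Rightarrow> real set" where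
  "psi_set \<phi> \<epsilon> \<equiv> {l. l \<ge> 1 \<and> (l = 1 \<or> \<epsilon> \<le> 1 - exp (- (Phi \<phi> (inverse l) / (l - 1))))}"

lemma Phi_le:
  assumes "\<And>x. x \<in> {0<..1} \<Longrightarrow> 0 \<le> \<phi> x" "0 < \<epsilon>" "\<epsilon> \<le> \<delta>" "\<delta> \<le> 1"
  shows "Phi \<phi> \<epsilon> \<le> inverse \<delta> * \<phi> \<delta>"
  unfolding Phi_def
  using assms by (intro cINF_lower bdd_belowI2[of _ 0] mult_nonneg_nonneg) auto

lemma psi_set_Phi_le:
  assumes l: "l \<in> psi_set \<phi> \<epsilon>" "l \<noteq> 1" and \<epsilon>: "\<epsilon> < 1"
  shows "(l - 1) * - ln (1 - \<epsilon>) \<le> Phi \<phi> (inverse l)"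
proof -
  have "exp (- (Phi \<phi> (inverse l) / (l - 1))) \<le> 1 - \<epsilon>" using l by simp
  hence "- (Phi \<phi> (inverse l) / (l - 1)) \<le> ln (1 - \<epsilon>)"
    using \<epsilon> by (subst ln_ge_iff) auto
  thus ?thesis using l by (simp add: field_simps)
qed

text \<open>
  The supremum dominates \<open>1\<close> only if the set is bounded above. It is, because
  $\Phi(\lambda^{-1}) \le \phi(1)$ turns the condition into
  $\lambda - 1 \le \phi(1) / (- \log (1 - \varepsilon))$.
\<close>

lemma psi_ge_1:
  assumes \<phi>: "\<And>x. x \<in> {0<..1} \<Longrightarrow> 0 \<le> \<phi> x" and \<epsilon>: "0 < \<epsilon>" "\<epsilon> < 1"
  shows "1 \<le> psi \<phi> \<epsilon>"
proof -
  have "l \<le> 1 + \<phi> 1 / - ln (1 - \<epsilon>)" if l: "l \<in> psi_set \<phi> \<epsilon>" for l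
  proof (cases "l = 1")
    case True
    thus ?thesis using \<phi>[of 1] \<epsilon> by (simp add: divide_nonneg_neg)
  next
    case False
    hence "l > 1" using l by auto
    have "(l - 1) * - ln (1 - \<epsilon>) \<le> Phi \<phi> (inverse l)"
      by (rule psi_set_Phi_le[OF l False \<epsilon>(2)])
    also have "\<dots> \<le> \<phi> 1"
      using Phi_le[of \<phi> "inverse l" 1] \<phi> \<open>l > 1\<close> by (simp add: field_simps)
    finally have "l - 1 \<le> \<phi> 1 / - ln (1 - \<epsilon>)"
      using \<epsilon> by (subst pos_le_divide_eq) auto
    thus ?thesis by simp
  qed
  hence "bdd_above (psi_set \<phi> \<epsilon>)" by (rule bdd_aboveI)
  thus ?thesis unfolding psi_def by (rule cSup_upper[rotated]) simp
qed

context
  fixes d :: nat and \<phi> :: "real \<Rightarrow> real" and \<epsilon> z :: real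
  assumes d: "1 \<le> d"
    and \<phi>: "\<And>x. x \<in> {0<..1} \<Longrightarrow> 0 \<le> \<phi> x"
    and tall: "\<And>n m :: nat. n \<ge> m \<Longrightarrow> m > 0 \<Longrightarrow>
      real (card {\<omega>. self_avoiding_bridge d n \<omega> \<and> goes_from_to \<omega> origin (upper_half_space d m)})
        \<le> real (sab_count d n) * exp (- \<phi> (real m / real n) * real n)"
    and \<epsilon>: "0 < \<epsilon>" "\<epsilon> < 1"
    and z: "z = (1 - \<epsilon>) / connective_constant d"
begin

lemma z_nonneg: "0 \<le> z"
  using connective_constant_ge_1[OF d] \<epsilon> by (simp add: z)

text \<open>
  The heart of the bound: long bridges are rare since $z$ is below $1/\mu$ by the factor
  $1 - \varepsilon$, and steep bridges are rare by hypothesis.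
\<close>

lemma card_bridges_le:
  assumes l: "l \<in> psi_set \<phi> \<epsilon>"
  shows "real (card {xs. xs \<in> bridges d m \<and> length xs = n}) * z ^ n \<le> (1 - \<epsilon>) powr (l * real m)"
proof -
  let ?b = "real (card {xs. xs \<in> bridges d m \<and> length xs = n})"
  have \<mu>: "1 \<le> connective_constant d" by (rule connective_constant_ge_1[OF d])
  have weight: "connective_constant d ^ n * z ^ n = (1 - \<epsilon>) powr real n"
    using \<mu> \<epsilon> by (simp add: z power_divide powr_realpow)
  consider "l * real m \<le> real n" | "real n < l * real m" "n < m" | "real n < l * real m" "m \<le> n"
    by linarith
  thus ?thesis
  proof cases
    case 1
    have "?b \<le> connective_constant d ^ n"
      using card_bridges_le_sab_count[of d m n] sab_count_le_connective_constant_power[OF d, of n] by simp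
    hence "?b * z ^ n \<le> connective_constant d ^ n * z ^ n"
      using z_nonneg by (intro mult_right_mono) auto
    also have "\<dots> \<le> (1 - \<epsilon>) powr (l * real m)"
      unfolding weight using 1 \<epsilon> by (intro powr_mono') auto
    finally show ?thesis .
  next
    case 2
    hence none: "{xs. xs \<in> bridges d m \<and> length xs = n} = {}"
      using bridges_height_le_length by fastforce
    show ?thesis unfolding none by simp
  next
    case 3
    have m: "m > 0" using 3 by (cases m) auto
    hence n: "n > 0" using 3 by simp
    have l1: "l > 1" using l 3 by (cases "l = 1") auto
    have "inverse l \<le> real m / real n"
      using 3 l1 n by (simp add: field_simps)
    hence "Phi \<phi> (inverse l) \<le> inverse (real m / real n) * \<phi> (real m / real n)"
      using l1 3 n by (intro Phi_le[OF \<phi>]) auto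
    hence "real m * Phi \<phi> (inverse l) \<le> \<phi> (real m / real n) * real n"
      using m n by (simp add: field_simps)
    moreover have "real m * ((l - 1) * - ln (1 - \<epsilon>)) \<le> real m * Phi \<phi> (inverse l)"
      using l1 by (intro mult_left_mono psi_set_Phi_le[OF l _ \<epsilon>(2)]) auto
    ultimately have "- \<phi> (real m / real n) * real n \<le> real m * (l - 1) * ln (1 - \<epsilon>)"
      by (simp add: algebra_simps)
    hence decay: "exp (- \<phi> (real m / real n) * real n) \<le> (1 - \<epsilon>) powr (real m * (l - 1))"
      using \<epsilon> by (simp add: powr_def)
    have "?b \<le> real (sab_count d n) * exp (- \<phi> (real m / real n) * real n)"
      using card_bridges_le_card_tall[of d m n] tall[OF 3(2) m] by linarith
    also have "\<dots> \<le> connective_constant d ^ n * (1 - \<epsilon>) powr (real m * (l - 1))"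
      using decay sab_count_le_connective_constant_power[OF d, of n] by (intro mult_mono) auto
    finally have "?b * z ^ n \<le> connective_constant d ^ n * (1 - \<epsilon>) powr (real m * (l - 1)) * z ^ n"
      using z_nonneg by (intro mult_right_mono) auto
    also have "\<dots> = (1 - \<epsilon>) powr real n * (1 - \<epsilon>) powr (real m * (l - 1))"
      unfolding weight[symmetric] by simp
    also have "\<dots> \<le> (1 - \<epsilon>) powr real m * (1 - \<epsilon>) powr (real m * (l - 1))"
      using 3 \<epsilon> by (intro mult_right_mono powr_mono') auto
    also have "\<dots> = (1 - \<epsilon>) powr (l * real m)"
      by (simp add: algebra_simps flip: powr_add)
    finally show ?thesis .
  qed
qed

lemma gf_bridges_le_powr:
  assumes l: "l \<in> psi_set \<phi> \<epsilon>"
  shows "gf (bridges d m) N z \<le> (1 - \<epsilon>) powr (l * real m)"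
proof (rule le_of_power_le_linear)
  fix k
  have "gf (bridges d m) N z ^ k \<le> gf (bridges d (k * m)) (k * N) z"
    by (rule gf_bridges_power_le[OF z_nonneg])
  also have "\<dots> \<le> (\<Sum>n\<le>k * N. (1 - \<epsilon>) powr (l * real (k * m)))"
    unfolding gf_eq_sum_card[OF bridges_saw] by (intro sum_mono card_bridges_le[OF l])
  also have "\<dots> = (real k * real N + 1) * ((1 - \<epsilon>) powr (l * real m)) ^ k"
    using \<epsilon> by (simp add: powr_power algebra_simps)
  finally show "gf (bridges d m) N z ^ k \<le> (real k * real N + 1) * ((1 - \<epsilon>) powr (l * real m)) ^ k" .
qed (simp_all add: gf_nonneg[OF z_nonneg])

text \<open>
  The bound for each $\lambda$ in the set passes to the supremum because, after taking logarithms,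
  it is an upper bound on $\lambda$ that does not depend on $\lambda$.
\<close>

lemma gf_bridges_le_power_psi:
  assumes m: "1 \<le> m"
  shows "gf (bridges d m) N z \<le> ((1 - \<epsilon>) powr psi \<phi> \<epsilon>) ^ m"
proof (cases "gf (bridges d m) N z = 0")
  case False
  define a where "a = gf (bridges d m) N z"
  have a: "0 < a" using False gf_nonneg[OF z_nonneg, of "bridges d m" N] by (simp add: a_def)
  have q: "real m * ln (1 - \<epsilon>) < 0"
    using m \<epsilon> by (intro mult_pos_neg) auto
  have "psi \<phi> \<epsilon> \<le> ln a / (real m * ln (1 - \<epsilon>))"
    unfolding psi_def
  proof (rule cSup_least)
    fix l assume "l \<in> psi_set \<phi> \<epsilon>"
    hence "a \<le> exp (l * real m * ln (1 - \<epsilon>))"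
      using gf_bridges_le_powr[of l m N] \<epsilon> by (simp add: a_def powr_def)
    hence "ln a \<le> l * (real m * ln (1 - \<epsilon>))"
      using ln_mono[of a "exp (l * real m * ln (1 - \<epsilon>))"] a by (simp add: mult.assoc)
    thus "l \<le> ln a / (real m * ln (1 - \<epsilon>))"
      using q by (simp add: neg_le_divide_eq)
  qed auto
  hence "ln a \<le> psi \<phi> \<epsilon> * (real m * ln (1 - \<epsilon>))"
    using q by (simp add: neg_le_divide_eq)
  hence "exp (ln a) \<le> exp (psi \<phi> \<epsilon> * real m * ln (1 - \<epsilon>))"
    by (simp only: exp_le_cancel_iff mult.assoc)
  also have "exp (psi \<phi> \<epsilon> * real m * ln (1 - \<epsilon>)) = ((1 - \<epsilon>) powr psi \<phi> \<epsilon>) ^ m"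
    using \<epsilon> by (simp add: powr_def mult_ac flip: exp_of_nat_mult)
  finally show ?thesis using a by (simp add: a_def)
qed simp

lemma gf_half_space_walks_le_exp:
  "gf (half_space_walks d A) N z \<le> exp (inverse (1 - (1 - \<epsilon>) powr psi \<phi> \<epsilon>) - 1)"
proof -
  define r where "r = (1 - \<epsilon>) powr psi \<phi> \<epsilon>"
  have r: "0 \<le> r" "r < 1"
    using psi_ge_1[of \<phi> \<epsilon>] \<phi> \<epsilon> by (auto simp: r_def powr_def mult_pos_neg)
  have "gf (half_space_walks d A) N z \<le> (\<Prod>m=1..A. 1 + gf (bridges d m) N z)"
    by (rule gf_half_space_walks_le[OF z_nonneg])
  also have "\<dots> \<le> (\<Prod>m=1..A. exp (r ^ m))"
  proof (rule prod_mono)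
    fix m assume "m \<in> {1..A}"
    hence "1 + gf (bridges d m) N z \<le> 1 + r ^ m"
      unfolding r_def using gf_bridges_le_power_psi by simp
    also have "\<dots> \<le> exp (r ^ m)" by (rule exp_ge_add_one_self)
    finally show "0 \<le> 1 + gf (bridges d m) N z \<and> 1 + gf (bridges d m) N z \<le> exp (r ^ m)"
      using gf_nonneg[OF z_nonneg, of "bridges d m" N] by simp
  qed
  also have "\<dots> = exp (\<Sum>m=1..A. r ^ m)" by (simp add: exp_sum)
  also have "(\<Sum>m=1..A. r ^ m) \<le> inverse (1 - r) - 1"
  proof -
    have "(\<Sum>m=1..A. r ^ m) = (\<Sum>m\<le>A. r ^ m) - 1"
      by (simp add: atMost_atLeast0 sum.atLeast_Suc_atMost)
    also have "(\<Sum>m\<le>A. r ^ m) \<le> inverse (1 - r)"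
    proof -
      have "(1 - r) * (\<Sum>m\<le>A. r ^ m) \<le> 1"
        unfolding sum_gp_basic using r by simp
      thus ?thesis using r by (simp add: inverse_eq_divide pos_le_divide_eq mult.commute)
    qed
    finally show ?thesis by simp
  qed
  finally show ?thesis by (simp add: r_def)
qed

lemma saw_count_le_exp:
  "real (saw_count d n) \<le> exp (2 * inverse (1 - (1 - \<epsilon>) powr psi \<phi> \<epsilon>)
      - (real n + 1) * ln (1 - \<epsilon>) - 2) * connective_constant d ^ (n + 1)"
proof -
  let ?E = "inverse (1 - (1 - \<epsilon>) powr psi \<phi> \<epsilon>)" and ?\<mu> = "connective_constant d"
  have \<mu>: "1 \<le> ?\<mu>" by (rule connective_constant_ge_1[OF d])
  have e: "(1 - \<epsilon>) ^ (n + 1) = exp ((real n + 1) * ln (1 - \<epsilon>))"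
    using \<epsilon> exp_of_nat_mult[of "n + 1" "ln (1 - \<epsilon>)"] by (simp add: add.commute)
  have "real (saw_count d n) * z ^ (n + 1) \<le> (gf (half_space_walks d (Suc n)) (Suc n) z)\<^sup>2"
    by (rule saw_count_le_half_space_walks[OF d z_nonneg])
  also have "\<dots> \<le> (exp (?E - 1))\<^sup>2"
    by (intro power_mono gf_half_space_walks_le_exp gf_nonneg[OF z_nonneg])
  also have "\<dots> = exp (2 * ?E - 2)"
    by (simp flip: exp_double)
  finally have "real (saw_count d n) * ((1 - \<epsilon>) ^ (n + 1) / ?\<mu> ^ (n + 1)) \<le> exp (2 * ?E - 2)"
    by (simp only: z power_divide)
  hence "real (saw_count d n) \<le> exp (2 * ?E - 2) / (1 - \<epsilon>) ^ (n + 1) * ?\<mu> ^ (n + 1)"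
    using \<epsilon> \<mu> by (simp add: field_simps)
  also have "exp (2 * ?E - 2) / (1 - \<epsilon>) ^ (n + 1) = exp (2 * ?E - (real n + 1) * ln (1 - \<epsilon>) - 2)"
    unfolding e by (simp add: algebra_simps flip: exp_diff)
  finally show ?thesis .
qed

end

section \<open>The bound on the number of self-avoiding walks\<close>

theorem theorem1p4:
  fixes d :: nat and \<phi> :: "real \<Rightarrow> real"
  assumes "d \<ge> 2"
    and "\<And>x. x \<in> {0<..1} \<Longrightarrow> 0 \<le> \<phi> x"
    and "mono_on {0<..1} \<phi>"
    and "\<And>n m :: nat. n \<ge> m \<Longrightarrow> m > 0 \<Longrightarrow>
      real (card {\<omega>. self_avoiding_bridge d n \<omega> \<and> goes_from_to \<omega> origin (upper_half_space d m)})
        \<le> real (sab_count d n) * exp (- \<phi> (real m / real n) * real n)"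
  shows "\<forall>n. real (saw_count d n) \<le> exp (Psi \<phi> n - 2) * connective_constant d ^ (n + 1)"
proof
  fix n
  let ?c = "real (saw_count d n)" and ?M = "connective_constant d ^ (n + 1)"
  have d: "1 \<le> d" using assms(1) by simp
  have M: "0 < ?M" using connective_constant_ge_1[OF d] by simp
  have c: "0 < ?c"
    using sab_count_pos[OF d, of n] sab_count_le_saw_count[of d n] by simp
  have "ln (?c / ?M) + 2 \<le> Psi \<phi> n"
    unfolding Psi_def
  proof (rule cINF_greatest)
    fix \<epsilon> :: real assume "\<epsilon> \<in> {0<..<1}"
    hence \<epsilon>: "0 < \<epsilon>" "\<epsilon> < 1" by auto
    let ?f = "2 * inverse (1 - (1 - \<epsilon>) powr psi \<phi> \<epsilon>) - (real n + 1) * ln (1 - \<epsilon>)"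
    have "?c / ?M \<le> exp (?f - 2)"
      using saw_count_le_exp[OF d assms(2) assms(4) \<epsilon> refl, of n] M by (simp add: pos_divide_le_eq)
    hence "ln (?c / ?M) \<le> ?f - 2"
      using ln_mono[of "?c / ?M" "exp (?f - 2)"] c M by simp
    thus "ln (?c / ?M) + 2 \<le> ?f" by simp
  qed auto
  hence "?c / ?M \<le> exp (Psi \<phi> n - 2)"
    using c M exp_le_cancel_iff[of "ln (?c / ?M)" "Psi \<phi> n - 2"] by simp
  thus "?c \<le> exp (Psi \<phi> n - 2) * ?M"
    using M by (simp add: pos_divide_le_eq)
qed

end
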